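(* Let $L\subseteq A^*$ be a language satisfying $\mathcal E_{ab=ba}$, $\mathcal E_{aab=abb}$ and $\mathcal E_{a=a.a}$ for every $a,b\in A$, and let $\mathcal Q=(Q_1,\dots,Q_\ell)$ be a finite colouring of $\mathbb N$ such that for every $a,b\in A$: $\bigcup_{i=1}^\ell A^*\otimes Q_i^2\subseteq E_{L,f_{a,b},f_{b,a}}$, $\bigcup_{i=1}^\ell A^*\otimes Q_i^3\subseteq E_{L,f_{a,a,b},f_{a,b,b}}$, and $\bigcup_{i=1}^\ell L_{Q_i}\otimes Q_i\subseteq E_{L,f_a,f_a.a}$. Then for any words $w,w'\in A^*$ with $w\sim_{\mathcal Q}w'$, we have $w\in L\iff w'\in L$.
   Context: $A$ is a finite alphabet. For $Q\subseteq\mathbb N$, $\langle w,Q\rangle:=\{a\in A:\exists i\in Q, i<|w|, w_i=a\}$; $w\sim_{\mathcal Q}w'$ means $\langle w,Q_i\rangle=\langle w',Q_i\rangle$ for all $i$. A finite colouring of $\mathbb N$ is a family of pairwise disjoint subsets covering $\mathbb N$. $A^*\otimes\mathbb N^n:=\{(w,j_1,\dots,j_n): j_m<|w|\}$, $A^*\otimes Q^n$ its subset with all $j_m\in Q$, $L_{Q}\otimes Q:=\{(w,j)\in A^*\otimes\mathbb N: j\in Q, |w|\in Q\}$. $E_{L,u,v}:=\{x: u(x)\in L\iff v(x)\in L\}$. $w((j_1,\dots,j_m)\to(b_1,\dots,b_m))$ replaces the letter at $j_r$ by $b_r$; $f_{a,b}(w,j_1,j_2):=w((j_1,j_2)\to(a,b))$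 if $j_1\neq j_2$, else $w$; $f_{a,a,b}(w,j_1,j_2,j_3):=w((j_1,j_2,j_3)\to(a,a,b))$ if pairwise distinct, else $w$ (similarly $f_{a,b,b}$); $f_a(w,i):=w(i\to a)$, $(f_a.a)(w,i):=w(i\to a)\,a$. $\beta(S)$ is the set of ultrafilters on $S$, $\beta f(\nu)=\{P: f^{-1}(P)\in\nu\}$; $L$ satisfies $\gamma_1\leftrightarrow\gamma_2$ iff ($L\in\gamma_1\iff L\in\gamma_2$); $\mathcal E^{p_1,\dots,p_n}_{u=v}$ is the family of equations $\beta u(\nu)\leftrightarrow\beta v(\nu)$ for $\nu\in\beta(A^*\otimes\mathbb N^n)$ with $\beta p_1(\nu)=\dots=\beta p_n(\nu)$; $\mathcal E_{ab=ba}:=\mathcal E^{\pi_1,\pi_2}_{f_{a,b}=f_{b,a}}$, $\mathcal E_{aab=abb}:=\mathcal E^{\pi_1,\pi_2,\pi_3}_{f_{a,a,b}=f_{a,b,b}}$, $\mathcal E_{a=a.a}:=\mathcal E^{\pi,|\cdot|}_{f_a=f_a.a}$ ($\pi_r$ coordinate projections, $\pi(w,i)=i$, $|\cdot|(w,i)=|w|$). *)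

theory Defs
  imports Main "HOL-Library.Disjoint_Sets"
begin

text \<open>
  The alphabet is a type of class \<open>finite\<close>, and words are lists, with positions counted from \<open>0\<close>.
  A tuple \<open>(w, j\<^sub>1, \<dots>, j\<^sub>n)\<close> is encoded as \<open>(w, [j\<^sub>1, \<dots>, j\<^sub>n])\<close>, so that one type serves every \<open>n\<close>.
\<close>

definition content :: "'a list \<Rightarrow> nat set \<Rightarrow> 'a set" where
  "content w Q = {a. \<exists>i\<in>Q. i < length w \<and> w ! i = a}"

definition finite_colouring :: "nat \<Rightarrow> (nat \<Rightarrow> nat set) \<Rightarrow> bool" where
  "finite_colouring l Q \<longleftrightarrow> disjoint_family_on Q {1..l} \<and> (\<Union>i\<in>{1..l}. Q i) = UNIV"

definition colour_equiv :: "nat \<Rightarrow> (nat \<Rightarrow> nat set) \<Rightarrow> 'a list \<Rightarrow> 'a list \<Rightarrow> bool" where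
  "colour_equiv l Q w w' \<longleftrightarrow> (\<forall>i\<in>{1..l}. content w (Q i) = content w' (Q i))"

definition marked_words :: "nat set \<Rightarrow> nat \<Rightarrow> ('a list \<times> nat list) set" where
  "marked_words Q n = {(w, js). length js = n \<and> (\<forall>j\<in>set js. j < length w \<and> j \<in> Q)}"

definition marked_words_length_in :: "nat set \<Rightarrow> ('a list \<times> nat list) set" where
  "marked_words_length_in Q = {(w, js) \<in> marked_words UNIV 1. js ! 0 \<in> Q \<and> length w \<in> Q}"

text \<open>
  The functions \<open>u\<close>, \<open>v\<close> are total in HOL, so this set also contains pairs outside their intended
  domain; it is only used as the right-hand side of inclusions whose left-hand sides lie in that
  domain.
\<close>

definition agree_set :: "'a list set \<Rightarrow> ('x \<Rightarrow> 'a list) \<Rightarrow> ('x \<Rightarrow> 'a list) \<Rightarrow> 'x set" where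
  "agree_set L u v = {x. u x \<in> L \<longleftrightarrow> v x \<in> L}"

definition replace :: "'a list \<Rightarrow> nat list \<Rightarrow> 'a list \<Rightarrow> 'a list" where
  "replace w js bs = fold (\<lambda>(j, b) v. v[j := b]) (zip js bs) w"

text \<open>
  \<open>subst_fun [a, b]\<close>, \<open>subst_fun [a, a, b]\<close>, \<open>subst_fun [a, b, b]\<close> and \<open>subst_fun [a]\<close> are
  \<open>f\<^sub>a\<^sub>,\<^sub>b\<close>, \<open>f\<^sub>a\<^sub>,\<^sub>a\<^sub>,\<^sub>b\<close>, \<open>f\<^sub>a\<^sub>,\<^sub>b\<^sub>,\<^sub>b\<close> and \<open>f\<^sub>a\<close>.
\<close>

definition subst_fun :: "'a list \<Rightarrow> 'a list \<times> nat list \<Rightarrow> 'a list" where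
  "subst_fun bs = (\<lambda>(w, js). if distinct js then replace w js bs else w)"

definition subst_append :: "'a \<Rightarrow> 'a list \<times> nat list \<Rightarrow> 'a list" where
  "subst_append a x = subst_fun [a] x @ [a]"

lemma subst_fun_1: "subst_fun [a] (w, [i]) = w[i := a]"
  by (simp add: subst_fun_def replace_def)

lemma subst_fun_2:
  "subst_fun [a, b] (w, [j1, j2]) = (if j1 \<noteq> j2 then w[j1 := a, j2 := b] else w)"
  by (simp add: subst_fun_def replace_def)

lemma subst_fun_3:
  "subst_fun [a, b, c] (w, [j1, j2, j3]) =
    (if j1 \<noteq> j2 \<and> j1 \<noteq> j3 \<and> j2 \<noteq> j3 then w[j1 := a, j2 := b, j3 := c] else w)"
  by (simp add: subst_fun_def replace_def)

text \<open>
  An ultrafilter on a set \<open>S\<close> is an ultrafilter on the ambient type that contains \<open>S\<close>. Membership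
  of a set \<open>P\<close> in a filter is \<open>eventually (\<lambda>x. x \<in> P)\<close>, and \<open>\<beta>f\<close> is \<open>filtermap f\<close>.
\<close>

definition ultrafilters_on :: "'x set \<Rightarrow> 'x filter set" where
  "ultrafilters_on S =
    {\<nu>. \<nu> \<noteq> bot \<and> eventually (\<lambda>x. x \<in> S) \<nu> \<and>
        (\<forall>P. eventually (\<lambda>x. x \<in> P) \<nu> \<or> eventually (\<lambda>x. x \<notin> P) \<nu>)}"

lemma filtermap_mem:
  "eventually (\<lambda>y. y \<in> P) (filtermap f \<nu>) \<longleftrightarrow> eventually (\<lambda>x. x \<in> f -` P) \<nu>"
  by (simp add: eventually_filtermap)

text \<open>An equation \<open>\<gamma>\<^sub>1 \<leftrightarrow> \<gamma>\<^sub>2\<close> is the pair \<open>(\<gamma>\<^sub>1, \<gamma>\<^sub>2)\<close>.\<close>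

definition satisfies :: "'a list set \<Rightarrow> 'a list filter \<times> 'a list filter \<Rightarrow> bool" where
  "satisfies L = (\<lambda>(\<gamma>1, \<gamma>2).
     eventually (\<lambda>w. w \<in> L) \<gamma>1 \<longleftrightarrow> eventually (\<lambda>w. w \<in> L) \<gamma>2)"

definition satisfies_all :: "'a list set \<Rightarrow> ('a list filter \<times> 'a list filter) set \<Rightarrow> bool" where
  "satisfies_all L E \<longleftrightarrow> (\<forall>e\<in>E. satisfies L e)"

text \<open>
  The argument \<open>n\<close> is the number of marked positions; it need not be the number of functions in \<open>ps\<close>.
\<close>

definition equations ::
  "nat \<Rightarrow> ('a list \<times> nat list \<Rightarrow> nat) list \<Rightarrow> ('a list \<times> nat list \<Rightarrow> 'a list) \<Rightarrow>
   ('a list \<times> nat list \<Rightarrow> 'a list) \<Rightarrow> ('a list filter \<times> 'a list filter) set" where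
  "equations n ps u v =
    {(filtermap u \<nu>, filtermap v \<nu>) | \<nu>.
       \<nu> \<in> ultrafilters_on (marked_words UNIV n) \<and>
       (\<forall>p\<in>set ps. \<forall>q\<in>set ps. filtermap p \<nu> = filtermap q \<nu>)}"

definition coord :: "nat \<Rightarrow> 'a list \<times> nat list \<Rightarrow> nat" where
  "coord r = (\<lambda>(w, js). js ! (r - 1))"

definition word_length :: "'a list \<times> nat list \<Rightarrow> nat" where
  "word_length = (\<lambda>(w, js). length w)"

definition eqs_ab_ba :: "'a \<Rightarrow> 'a \<Rightarrow> ('a list filter \<times> 'a list filter) set" where
  "eqs_ab_ba a b = equations 2 [coord 1, coord 2] (subst_fun [a, b]) (subst_fun [b, a])"

definition eqs_aab_abb :: "'a \<Rightarrow> 'a \<Rightarrow> ('a list filter \<times> 'a list filter) set" where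
  "eqs_aab_abb a b =
    equations 3 [coord 1, coord 2, coord 3] (subst_fun [a, a, b]) (subst_fun [a, b, b])"

definition eqs_a_aa :: "'a \<Rightarrow> ('a list filter \<times> 'a list filter) set" where
  "eqs_a_aa a = equations 1 [coord 1, word_length] (subst_fun [a]) (subst_append a)"

end

theory Submission
  imports Defs
begin

text \<open>
  Two words of equal length with the same letters on each colour are connected by induction on the
  number of positions where they differ. Let \<open>i\<close> be such a position, with letters \<open>a\<close> in \<open>w\<close> and
  \<open>b\<close> in \<open>w'\<close>. If \<open>a\<close> occurs in \<open>w\<close> at a second position of the colour of \<open>i\<close>, then the rule
  \<open>aab = abb\<close> rewrites the letter of \<open>w\<close> at \<open>i\<close> to \<open>b\<close>. Otherwise \<open>w'\<close> has the letter \<open>a\<close> at some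
  \<open>k \<noteq> i\<close> of the same colour, where \<open>w\<close> has a different letter, and exchanging the letters of \<open>w'\<close>
  at \<open>i\<close> and \<open>k\<close> with the rule \<open>ab = ba\<close> removes the difference at \<open>i\<close> without creating a new one.
  A shorter word is first brought to the length of the longer one with the rule \<open>a = a.a\<close>: the
  longer word has a letter at the position to be filled, so its colour already occurs in the
  shorter word.
\<close>

text \<open>When \<open>col\<close> gives the index of the colour of each position, the slice of
  this set at \<open>c\<close> is \<open>content w (Q c)\<close>. A single set equality thus
  replaces the family of equalities in \<open>colour_equiv\<close>.\<close>

definition coloured_letters :: "(nat \<Rightarrow> 'c) \<Rightarrow> 'a list \<Rightarrow> ('c \<times> 'a) set" where
  "coloured_letters col w = (\<lambda>i. (col i, w ! i)) ` {..<length w}"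

definition differences :: "'a list \<Rightarrow> 'a list \<Rightarrow> nat set" where
  "differences w w' = {i. i < length w \<and> w ! i \<noteq> w' ! i}"

lemma finite_differences: "finite (differences w w')"
  by (simp add: differences_def)

lemma coloured_letters_swap:
  assumes "i < length w" "k < length w" "col i = col k"
  shows "coloured_letters col (w[i := w ! k, k := w ! i]) = coloured_letters col w"
proof -
  let ?v = "w[i := w ! k, k := w ! i]"
  \<comment> \<open>The swapped word is \<open>w\<close> read along the transposition
    \<open>?s\<close>, which permutes the positions and preserves their colours.\<close>
  let ?s = "\<lambda>j. if j = i then k else if j = k then i else j"
  have eq: "(col j, ?v ! j) = (col (?s j), w ! ?s j)" if "j < length w" for j
    using assms that by (auto simp: nth_list_update)
  have s: "?s ` {..<length w} = {..<length w}"
    using assms(1,2) by (auto simp: image_iff)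
  have "coloured_letters col ?v = (\<lambda>j. (col (?s j), w ! ?s j)) ` {..<length w}"
    unfolding coloured_letters_def using eq by (intro image_cong) auto
  also have "\<dots> = (\<lambda>j. (col j, w ! j)) ` ?s ` {..<length w}"
    by (simp only: image_image)
  finally show ?thesis
    by (simp only: s coloured_letters_def)
qed

text \<open>Nothing is gained, since the new letter already occurs at \<open>j\<close>, and nothing
  is lost, since the overwritten letter survives at \<open>k\<close>; both positions have the colour
  of \<open>i\<close>.\<close>

lemma coloured_letters_update:
  assumes "i < length w" "j < length w" "k < length w" "i \<noteq> j" "i \<noteq> k"
    and "col j = col i" "col k = col i" "w ! k = w ! i"
  shows "coloured_letters col (w[i := w ! j]) = coloured_letters col w"
proof (intro equalityI subsetI)
  fix x assume "x \<in> coloured_letters col (w[i := w ! j])"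
  then obtain m where m: "m < length w" "x = (col m, w[i := w ! j] ! m)"
    by (auto simp: coloured_letters_def)
  let ?m = "if m = i then j else m"
  have "?m < length w" "x = (col ?m, w ! ?m)"
    using assms m by auto
  then show "x \<in> coloured_letters col w"
    unfolding coloured_letters_def by (intro image_eqI[where x = ?m]) (simp_all only: length_list_update lessThan_iff)
next
  fix x assume "x \<in> coloured_letters col w"
  then obtain m where m: "m < length w" "x = (col m, w ! m)"
    by (auto simp: coloured_letters_def)
  let ?m = "if m = i then k else m"
  have "?m < length w" "x = (col ?m, w[i := w ! j] ! ?m)"
    using assms m by auto
  then show "x \<in> coloured_letters col (w[i := w ! j])"
    unfolding coloured_letters_def by (intro image_eqI[where x = ?m]) (simp_all only: length_list_update lessThan_iff)
qed

lemma mem_iff_if_coloured_letters_eq_same_length: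
  assumes swap: "\<And>w i j a b. i < length w \<Longrightarrow> j < length w \<Longrightarrow> i \<noteq> j \<Longrightarrow> col i = col j \<Longrightarrow>
      w[i := a, j := b] \<in> L \<longleftrightarrow> w[i := b, j := a] \<in> L"
    and dup: "\<And>w i j k a b. i < length w \<Longrightarrow> j < length w \<Longrightarrow> k < length w \<Longrightarrow>
      i \<noteq> j \<Longrightarrow> i \<noteq> k \<Longrightarrow> j \<noteq> k \<Longrightarrow> col i = col j \<Longrightarrow> col k = col j \<Longrightarrow>
      w[i := a, j := a, k := b] \<in> L \<longleftrightarrow> w[i := a, j := b, k := b] \<in> L"
    and "length w = length w'" "coloured_letters col w = coloured_letters col w'"
  shows "w \<in> L \<longleftrightarrow> w' \<in> L"
  using assms(3,4)
proof (induction "card (differences w w')" arbitrary: w w' rule: less_induct)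
  case less
  show ?case
  proof (cases "w = w'")
    case False
    then obtain i where i: "i < length w" "w ! i \<noteq> w' ! i"
      using less.prems(1) nth_equalityI by blast
    have "(col i, w' ! i) \<in> coloured_letters col w"
      using i less.prems by (auto simp: coloured_letters_def)
    then obtain j where j: "j < length w" "col j = col i" "w ! j = w' ! i"
      by (auto simp: coloured_letters_def)
    have "(col i, w ! i) \<in> coloured_letters col w'"
      unfolding less.prems(2)[symmetric] using i by (auto simp: coloured_letters_def)
    then obtain k where k: "k < length w'" "col k = col i" "w' ! k = w ! i"
      by (auto simp: coloured_letters_def)
    have ij: "i \<noteq> j" and ik: "i \<noteq> k"
      using i j k by auto
    show ?thesis
    proof (cases "\<exists>m<length w. m \<noteq> i \<and> col m = col i \<and> w ! m = w ! i")
      case True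
      then obtain m where m: "m < length w" "m \<noteq> i" "col m = col i" "w ! m = w ! i"
        by blast
      \<comment> \<open>The rule \<open>dup\<close> needs three distinct positions: \<open>m\<close>
        and \<open>i\<close> carry the old letter, and \<open>j\<close> is a place where
        \<open>w\<close> already has the letter wanted at \<open>i\<close>. One side of the rule is
        then \<open>w\<close> itself, and the other changes \<open>w\<close> only at
        \<open>i\<close>.\<close>
      have mj: "m \<noteq> j"
        using i j m by auto
      let ?v = "w[i := w ! j]"
      have "w[m := w ! i, i := w ! i, j := w ! j] = w"
        using m by (metis list_update_id)
      moreover have "w[m := w ! i, i := w ! j, j := w ! j] = ?v"
        using m ij by (metis list_update_id list_update_swap)
      ultimately have "w \<in> L \<longleftrightarrow> ?v \<in> L"
        using dup[of m w i j "w ! i" "w ! j"] i j m ij mj by metis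
      moreover have "?v \<in> L \<longleftrightarrow> w' \<in> L"
      proof (rule less.hyps)
        have "differences ?v w' \<subset> differences w w'"
          using i j by (auto simp: differences_def nth_list_update split: if_splits)
        then show "card (differences ?v w') < card (differences w w')"
          by (simp add: finite_differences psubset_card_mono)
        show "length ?v = length w'"
          using less.prems by simp
        show "coloured_letters col ?v = coloured_letters col w'"
          using coloured_letters_update[of i w j m col] i j m ij less.prems by auto
      qed
      ultimately show ?thesis by blast
    next
      case False
      then have wk: "w ! k \<noteq> w ! i"
        using k ik less.prems(1) by auto
      let ?v = "w'[i := w' ! k, k := w' ! i]"
      have "w'[i := w' ! i, k := w' ! k] = w'"
        by simp
      then have "w' \<in> L \<longleftrightarrow> ?v \<in> L"
        using swap[of i w' k "w' ! i" "w' ! k"] i k ik less.prems(1) by auto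
      moreover have "w \<in> L \<longleftrightarrow> ?v \<in> L"
      proof (rule less.hyps)
        have "differences w ?v \<subset> differences w w'"
          using i k ik wk less.prems(1)
          by (auto simp: differences_def nth_list_update split: if_splits)
        then show "card (differences w ?v) < card (differences w w')"
          by (simp add: finite_differences psubset_card_mono)
        show "length w = length ?v"
          using less.prems by simp
        show "coloured_letters col w = coloured_letters col ?v"
          using coloured_letters_swap[of i w' k col] i k less.prems by auto
      qed
      ultimately show ?thesis by blast
    qed
  qed simp
qed

lemma extend_preserving_coloured_letters:
  assumes app: "\<And>w i. i < length w \<Longrightarrow> col i = col (length w) \<Longrightarrow> w \<in> L \<longleftrightarrow> w @ [w ! i] \<in> L"
    and "length w \<le> length w'" "coloured_letters col w = coloured_letters col w'"
  obtains v where "length v = length w'" "coloured_letters col v = coloured_letters col w'"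
    "v \<in> L \<longleftrightarrow> w \<in> L"
proof -
  have "\<exists>v. length v = length w' \<and> coloured_letters col v = coloured_letters col w' \<and>
      (v \<in> L \<longleftrightarrow> w \<in> L)"
    using assms(2,3)
  proof (induction "length w' - length w" arbitrary: w)
    case (Suc n)
    let ?n = "length w"
    have "(col ?n, w' ! ?n) \<in> coloured_letters col w"
      using Suc by (auto simp: coloured_letters_def)
    then obtain i where i: "i < ?n" "col i = col ?n"
      by (auto simp: coloured_letters_def)
    \<comment> \<open>The appended letter is copied from a position with the colour of
      \<open>?n\<close>, so its coloured pair is not new. It may differ from the letter of
      \<open>w'\<close> at \<open>?n\<close>; only the length has to catch up.\<close>
    let ?u = "w @ [w ! i]"
    have "coloured_letters col ?u = insert (col ?n, w ! i) (coloured_letters col w)"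
      by (auto simp: coloured_letters_def lessThan_Suc nth_append)
    also have "\<dots> = coloured_letters col w"
    proof (rule insert_absorb)
      have "(col i, w ! i) \<in> coloured_letters col w"
        using i(1) by (auto simp: coloured_letters_def)
      then show "(col ?n, w ! i) \<in> coloured_letters col w"
        by (simp only: i(2))
    qed
    finally have u: "coloured_letters col ?u = coloured_letters col w'"
      using Suc.prems(2) by simp
    have "n = length w' - length ?u" "length ?u \<le> length w'"
      using Suc.hyps(2) by auto
    from Suc.hyps(1)[OF this u]
    obtain v where "length v = length w'" "coloured_letters col v = coloured_letters col w'"
      "v \<in> L \<longleftrightarrow> ?u \<in> L"
      by blast
    then show ?case
      using app[OF i] by blast
  qed auto
  then show ?thesis
    using that by blast
qed

theorem mainTheorem15:
  fixes L :: "'a::finite list set"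
    and l :: nat
    and Q :: "nat \<Rightarrow> nat set"
    and w w' :: "'a list"
  assumes "\<And>a b. satisfies_all L (eqs_ab_ba a b)"
    and "\<And>a b. satisfies_all L (eqs_aab_abb a b)"
    and "\<And>a. satisfies_all L (eqs_a_aa a)"
    and "finite_colouring l Q"
    and "\<And>a b. (\<Union>i\<in>{1..l}. marked_words (Q i) 2)
                  \<subseteq> agree_set L (subst_fun [a, b]) (subst_fun [b, a])"
    and "\<And>a b. (\<Union>i\<in>{1..l}. marked_words (Q i) 3)
                  \<subseteq> agree_set L (subst_fun [a, a, b]) (subst_fun [a, b, b])"
    and "\<And>a. (\<Union>i\<in>{1..l}. marked_words_length_in (Q i))
                \<subseteq> agree_set L (subst_fun [a]) (subst_append a)"
    and "colour_equiv l Q w w'"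
  shows "w \<in> L \<longleftrightarrow> w' \<in> L"
proof -
  have "\<forall>i. \<exists>c\<in>{1..l}. i \<in> Q c"
    using assms(4) unfolding finite_colouring_def by blast
  then obtain col where col: "\<And>i. col i \<in> {1..l}" "\<And>i. i \<in> Q (col i)"
    by metis
  \<comment> \<open>Covering gave the choice function \<open>col\<close>; disjointness makes the
    chosen index the only one.\<close>
  have Q: "i \<in> Q c \<longleftrightarrow> col i = c" if "c \<in> {1..l}" for i c
    using col[of i] that assms(4) unfolding finite_colouring_def disjoint_family_on_def by blast
  have content: "a \<in> content v (Q c) \<longleftrightarrow> (c, a) \<in> coloured_letters col v"
    if "c \<in> {1..l}" for a c and v :: "'a list"
    using Q[OF that] by (auto simp: content_def coloured_letters_def)
  have fst_coloured: "c \<in> {1..l}" if "(c, a) \<in> coloured_letters col v" for a c and v :: "'a list"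
    using that col(1) by (auto simp: coloured_letters_def)
  have letters_eq: "coloured_letters col w = coloured_letters col w'"
  proof (intro equalityI subrelI)
    fix c a assume "(c, a) \<in> coloured_letters col w"
    then show "(c, a) \<in> coloured_letters col w'"
      using content fst_coloured assms(8) unfolding colour_equiv_def by metis
  next
    fix c a assume "(c, a) \<in> coloured_letters col w'"
    then show "(c, a) \<in> coloured_letters col w"
      using content fst_coloured assms(8) unfolding colour_equiv_def by metis
  qed
  have swap: "v[i := a, j := b] \<in> L \<longleftrightarrow> v[i := b, j := a] \<in> L"
    if "i < length v" "j < length v" "i \<noteq> j" "col i = col j" for v i j a b
  proof -
    have "(v, [i, j]) \<in> marked_words (Q (col j)) 2"
      using that col(2)[of i] col(2)[of j] by (simp add: marked_words_def)
    then have "(v, [i, j]) \<in> agree_set L (subst_fun [a, b]) (subst_fun [b, a])"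
      using assms(5)[of a b] col(1)[of j] by blast
    then show ?thesis
      using that by (simp add: agree_set_def subst_fun_2)
  qed
  have dup: "v[i := a, j := a, k := b] \<in> L \<longleftrightarrow> v[i := a, j := b, k := b] \<in> L"
    if "i < length v" "j < length v" "k < length v" "i \<noteq> j" "i \<noteq> k" "j \<noteq> k"
      "col i = col j" "col k = col j" for v i j k a b
  proof -
    have "(v, [i, j, k]) \<in> marked_words (Q (col j)) 3"
      using that col(2)[of i] col(2)[of j] col(2)[of k] by (simp add: marked_words_def)
    then have "(v, [i, j, k]) \<in> agree_set L (subst_fun [a, a, b]) (subst_fun [a, b, b])"
      using assms(6)[of a b] col(1)[of j] by blast
    then show ?thesis
      using that by (simp add: agree_set_def subst_fun_3)
  qed
  have app: "v \<in> L \<longleftrightarrow> v @ [v ! i] \<in> L" if "i < length v" "col i = col (length v)" for v i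
  proof -
    have "(v, [i]) \<in> marked_words_length_in (Q (col i))"
      using that col(2)[of i] col(2)[of "length v"]
      by (simp add: marked_words_length_in_def marked_words_def)
    \<comment> \<open>Substituting the letter that already stands at \<open>i\<close> leaves
      \<open>v\<close> unchanged, so the two sides become \<open>v\<close> and
      \<open>v @ [v ! i]\<close>.\<close>
    then have "(v, [i]) \<in> agree_set L (subst_fun [v ! i]) (subst_append (v ! i))"
      using assms(7)[of "v ! i"] col(1)[of i] by blast
    then show ?thesis
      by (simp add: agree_set_def subst_append_def subst_fun_1)
  qed
  have same_length: "u \<in> L \<longleftrightarrow> v \<in> L"
    if "length u = length v" "coloured_letters col u = coloured_letters col v" for u v
    using mem_iff_if_coloured_letters_eq_same_length[of col L u v, OF swap dup that] .
  have le: "u \<in> L \<longleftrightarrow> v \<in> L"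
    if "length u \<le> length v" "coloured_letters col u = coloured_letters col v" for u v
    using extend_preserving_coloured_letters[of col L u v, OF app that] same_length by metis
  show ?thesis
    using le[of w w'] le[of w' w] letters_eq by (cases "length w \<le> length w'") auto
qed

end
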